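(* Let $(X_n)_{n\in\mathbb{T}}$ be a (possibly time-inhomogeneous, non-stationary) Markov chain on a finite state space $\mathbb{S}$, with committors $q^+(n)$, $q^-(n)$. Then for all $n\in\mathbb{T}$ and $i\in C$ the distribution of reactive trajectories satisfies $$\mu^{AB}_i(n)=q_i^-(n)\,\mathbb{P}(X_n=i)\,q_i^+(n),$$ and the same identity holds for all $i\in\mathbb{S}$.
   Context: $A,B\subset\mathbb{S}$ are non-empty disjoint subsets of the finite state space $\mathbb{S}$ with $C:=(A\cup B)^c$ non-empty. The time set is $\mathbb{T}=\mathbb{Z}$ or $\mathbb{T}=\{0,1,\dots,N-1\}$. For $S\subset\mathbb{S}$ and $n\in\mathbb{T}$: $\tau_S^+(n):=\inf\{k\in\mathbb{T}: k\ge n, X_k\in S\}$ ($\inf\emptyset:=\infty$), $\tau_S^-(n):=\sup\{k\in\mathbb{T}: k\le n, X_k\in S\}$ ($\sup\emptyset:=-\infty$). The committors are $q_i^+(n):=\mathbb{P}(\tau_B^+(n)<\tau_A^+(n)\mid X_n=i)$ and $q_i^-(n):=\mathbb{P}(\tau_A^-(n)>\tau_B^-(n)\mid X_n=i)$. The distribution of reactive trajectories is $\mu^{AB}_i(n):=\mathbb{P}(X_n=i,\ \tau_A^-(n)>\tau_B^-(n),\ \tau_B^+(n)<\tau_A^+(n))$ for $i\in\mathbb{S}$. If $\mathbb{P}(X_n=i)=0$, the committors at $(n,i)$ may be given arbitrary values in $[0,1]$; a product containing the factor $\mathbb{P}(X_n=i)=0$ is $0$. *)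

theory Defs
  imports "HOL-Probability.Probability"
begin

definition time_set :: "int set \<Rightarrow> bool" where
  "time_set T \<longleftrightarrow> T = UNIV \<or> (\<exists>N::nat. N \<ge> 1 \<and> T = {0..int N - 1})"

text \<open>
  Elementary Markov property on a finite state space. The process is indexed by all integers, but
  only the variables \<open>X n\<close> with \<open>n \<in> T\<close> matter. The transition
  probabilities may depend on \<open>n\<close> and the one-time marginals are arbitrary. The
  conditioning is on every finite stretch \<open>m, \<dots>, n\<close> of the past, since for
  \<open>T = UNIV\<close> the chain has no initial time.
\<close>

locale markov_chain = prob_space M
  for M :: "'w measure" +
  fixes T :: "int set" and \<S> :: "'s set" and X :: "int \<Rightarrow> 'w \<Rightarrow> 's"
  assumes time_set: "time_set T"
    and finite_states: "finite \<S>"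
    and measurable_X: "n \<in> T \<Longrightarrow> X n \<in> measurable M (count_space \<S>)"
    and markov_property:
      "\<lbrakk>m \<in> T; n \<in> T; n + 1 \<in> T; m \<le> n; \<P>(\<omega> in M. \<forall>k\<in>{m..n}. X k \<omega> = x k) > 0\<rbrakk> \<Longrightarrow>
         \<P>(\<omega> in M. X (n + 1) \<omega> = j \<bar> \<forall>k\<in>{m..n}. X k \<omega> = x k) =
         \<P>(\<omega> in M. X (n + 1) \<omega> = j \<bar> X n \<omega> = x n)"

text \<open>
  Times are embedded into the extended reals, where the infimum of the empty set is
  \<open>\<infinity>\<close> and the supremum of the empty set is \<open>-\<infinity>\<close>.
\<close>

definition first_entrance ::
  "int set \<Rightarrow> (int \<Rightarrow> 'w \<Rightarrow> 's) \<Rightarrow> 's set \<Rightarrow> int \<Rightarrow> 'w \<Rightarrow> ereal" where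
  "first_entrance T X D n \<omega> = (INF k\<in>{k \<in> T. k \<ge> n \<and> X k \<omega> \<in> D}. ereal (of_int k))"

definition last_exit ::
  "int set \<Rightarrow> (int \<Rightarrow> 'w \<Rightarrow> 's) \<Rightarrow> 's set \<Rightarrow> int \<Rightarrow> 'w \<Rightarrow> ereal" where
  "last_exit T X D n \<omega> = (SUP k\<in>{k \<in> T. k \<le> n \<and> X k \<omega> \<in> D}. ereal (of_int k))"

text \<open>
  A committor is determined only at those \<open>(n, i)\<close> with
  \<open>\<P>(X n = i) > 0\<close>; elsewhere any value in \<open>[0, 1]\<close> is
  admitted. Hence the committors are predicates on functions \<open>q\<close>, where
  \<open>q n i\<close> is the value at time \<open>n\<close> in state \<open>i\<close>.
\<close>

definition forward_committor ::
  "'w measure \<Rightarrow> int set \<Rightarrow> 's set \<Rightarrow> (int \<Rightarrow> 'w \<Rightarrow> 's) \<Rightarrow> 's set \<Rightarrow> 's set \<Rightarrow>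
   (int \<Rightarrow> 's \<Rightarrow> real) \<Rightarrow> bool" where
  "forward_committor M T \<S> X A B q \<longleftrightarrow>
     (\<forall>n\<in>T. \<forall>i\<in>\<S>. 0 \<le> q n i \<and> q n i \<le> 1 \<and>
        (\<P>(\<omega> in M. X n \<omega> = i) > 0 \<longrightarrow>
           q n i = \<P>(\<omega> in M. first_entrance T X B n \<omega> < first_entrance T X A n \<omega> \<bar> X n \<omega> = i)))"

definition backward_committor ::
  "'w measure \<Rightarrow> int set \<Rightarrow> 's set \<Rightarrow> (int \<Rightarrow> 'w \<Rightarrow> 's) \<Rightarrow> 's set \<Rightarrow> 's set \<Rightarrow>
   (int \<Rightarrow> 's \<Rightarrow> real) \<Rightarrow> bool" where
  "backward_committor M T \<S> X A B q \<longleftrightarrow>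
     (\<forall>n\<in>T. \<forall>i\<in>\<S>. 0 \<le> q n i \<and> q n i \<le> 1 \<and>
        (\<P>(\<omega> in M. X n \<omega> = i) > 0 \<longrightarrow>
           q n i = \<P>(\<omega> in M. last_exit T X A n \<omega> > last_exit T X B n \<omega> \<bar> X n \<omega> = i)))"

definition reactive_distribution ::
  "'w measure \<Rightarrow> int set \<Rightarrow> (int \<Rightarrow> 'w \<Rightarrow> 's) \<Rightarrow> 's set \<Rightarrow> 's set \<Rightarrow> int \<Rightarrow> 's \<Rightarrow> real" where
  "reactive_distribution M T X A B n i =
     \<P>(\<omega> in M. X n \<omega> = i \<and> last_exit T X A n \<omega> > last_exit T X B n \<omega> \<and>
       first_entrance T X B n \<omega> < first_entrance T X A n \<omega>)"

end

theory Submission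
  imports Defs
begin

text \<open>
  Whether a trajectory is reactive at time \<open>n\<close> is a conjunction of an event about the past,
  ``\<open>A\<close> was visited more recently than \<open>B\<close>'', and one about the future, ``\<open>B\<close> is visited
  before \<open>A\<close>''. For a Markov chain past and future are conditionally independent given the
  present, so
  \<open>P(X n = i, past, future) * P(X n = i) = P(X n = i, past) * P(X n = i, future)\<close>,
  which after division by \<open>P(X n = i)\<close> is the product formula with the two committors
  (lemma \<open>reactive_factorization\<close>).

  The Markov property is given in its one-step form, with conditioning on finite stretches
  of the past, so the conditional independence has to be built up. It holds for single
  finite paths by induction on the last time (lemma \<open>cylinder_factorization\<close>), hence, by summing
  over finitely many paths, for events that depend on finitely many times
  (lemma \<open>finite_window_factorization\<close>), and hence, by continuity from below, for increasing
  limits of such events (lemma \<open>past_future_factorization\<close>). Both events of interest are such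
  limits: each says that there is a time at which the path is in one of the two sets and between
  which and \<open>n\<close> it avoids the other (lemmas \<open>first_entrance_less_iff\<close> and
  \<open>last_exit_less_iff\<close>); looking for this time only at distance at most \<open>p\<close> from \<open>n\<close> gives an
  event that depends on finitely many times and increases with \<open>p\<close>.
\<close>

section \<open>Comparing hitting times\<close>

text \<open>
  The infimum defining the left-hand time is below the right-hand time iff some visit to \<open>B\<close>
  is. That a visit at time \<open>k\<close> comes before all visits to \<open>A\<close> also makes it strictly less than
  their infimum, attained or not: times are integers, so these visits are all at
  \<open>k + 1\<close> or later.
\<close>

lemma first_entrance_less_iff:
  "first_entrance T X B n \<omega> < first_entrance T X A n \<omega> \<longleftrightarrow>
     (\<exists>k\<in>T. n \<le> k \<and> X k \<omega> \<in> B \<and> (\<forall>l\<in>T \<inter> {n..k}. X l \<omega> \<notin> A))"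
proof -
  have "ereal (of_int k) < first_entrance T X A n \<omega> \<longleftrightarrow> (\<forall>l\<in>T \<inter> {n..k}. X l \<omega> \<notin> A)" for k
  proof
    assume "ereal (of_int k) < first_entrance T X A n \<omega>"
    then show "\<forall>l\<in>T \<inter> {n..k}. X l \<omega> \<notin> A"
      unfolding first_entrance_def by (force dest: less_INF_D)
  next
    assume avoid: "\<forall>l\<in>T \<inter> {n..k}. X l \<omega> \<notin> A"
    have "ereal (of_int k) < ereal (of_int (k + 1))"
      by simp
    also have "\<dots> \<le> first_entrance T X A n \<omega>"
      unfolding first_entrance_def
    proof (rule INF_greatest)
      fix l assume "l \<in> {l \<in> T. n \<le> l \<and> X l \<omega> \<in> A}"
      with avoid have "k + 1 \<le> l"
        by force
      then show "ereal (of_int (k + 1)) \<le> ereal (of_int l)"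
        by (simp del: of_int_add)
    qed
    finally show "ereal (of_int k) < first_entrance T X A n \<omega>" .
  qed
  then show ?thesis
    unfolding first_entrance_def[of T X B] by (auto simp: INF_less_iff)
qed

lemma last_exit_less_iff:
  "last_exit T X B n \<omega> < last_exit T X A n \<omega> \<longleftrightarrow>
     (\<exists>k\<in>T. k \<le> n \<and> X k \<omega> \<in> A \<and> (\<forall>l\<in>T \<inter> {k..n}. X l \<omega> \<notin> B))"
proof -
  have "last_exit T X B n \<omega> < ereal (of_int k) \<longleftrightarrow> (\<forall>l\<in>T \<inter> {k..n}. X l \<omega> \<notin> B)" for k
  proof
    assume "last_exit T X B n \<omega> < ereal (of_int k)"
    then show "\<forall>l\<in>T \<inter> {k..n}. X l \<omega> \<notin> B"
      unfolding last_exit_def by (force dest: SUP_lessD)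
  next
    assume avoid: "\<forall>l\<in>T \<inter> {k..n}. X l \<omega> \<notin> B"
    have "last_exit T X B n \<omega> \<le> ereal (of_int (k - 1))"
      unfolding last_exit_def
    proof (rule SUP_least)
      fix l assume "l \<in> {l \<in> T. l \<le> n \<and> X l \<omega> \<in> B}"
      with avoid have "l \<le> k - 1"
        by force
      then show "ereal (of_int l) \<le> ereal (of_int (k - 1))"
        by (simp del: of_int_diff)
    qed
    also have "\<dots> < ereal (of_int k)"
      by simp
    finally show "last_exit T X B n \<omega> < ereal (of_int k)" .
  qed
  then show ?thesis
    unfolding last_exit_def[of T X A] by (auto simp: less_SUP_iff)
qed

section \<open>Events that depend on finitely many times\<close>

text \<open>
  Events are given as predicates \<open>U\<close> on paths, evaluated at the random path \<open>\<lambda>k. X k \<omega>\<close>. Since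
  such a path is a total function, the times that matter are recorded as a set \<open>J\<close>.
\<close>

definition depends_only_on :: "(('t \<Rightarrow> 's) \<Rightarrow> bool) \<Rightarrow> 't set \<Rightarrow> bool" where
  "depends_only_on U J \<longleftrightarrow> (\<forall>x y. (\<forall>k\<in>J. x k = y k) \<longrightarrow> U x = U y)"

lemma depends_only_onD:
  "depends_only_on U J \<Longrightarrow> (\<And>k. k \<in> J \<Longrightarrow> x k = y k) \<Longrightarrow> U x = U y"
  unfolding depends_only_on_def by blast

lemma depends_only_on_conj:
  "depends_only_on U J \<Longrightarrow> depends_only_on V K \<Longrightarrow> depends_only_on (\<lambda>x. U x \<and> V x) (J \<union> K)"
  unfolding depends_only_on_def by (metis UnI1 UnI2)

context markov_chain
begin

lemma interval_subset_time_set: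
  assumes "m \<in> T" "n \<in> T"
  shows "{m..n} \<subseteq> T"
  using time_set assms unfolding time_set_def by auto

lemma state_in_space:
  "k \<in> T \<Longrightarrow> \<omega> \<in> space M \<Longrightarrow> X k \<omega> \<in> \<S>"
  using measurable_space[OF measurable_X] by force

lemma state_event:
  assumes "k \<in> T"
  shows "{\<omega> \<in> space M. X k \<omega> = s} \<in> events"
proof (cases "s \<in> \<S>")
  case True
  then have "X k -` {s} \<inter> space M \<in> events"
    by (intro measurable_sets[OF measurable_X[OF assms]]) auto
  also have "X k -` {s} \<inter> space M = {\<omega> \<in> space M. X k \<omega> = s}"
    by auto
  finally show ?thesis .
next
  case False
  then have "{\<omega> \<in> space M. X k \<omega> = s} = {}"
    using state_in_space[OF assms] by auto
  then show ?thesis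
    by (simp only: sets.empty_sets)
qed

lemma cylinder_event:
  assumes "finite J" "J \<subseteq> T"
  shows "{\<omega> \<in> space M. \<forall>k\<in>J. X k \<omega> = x k} \<in> events"
  using assms by (intro sets.sets_Collect_finite_All state_event) auto

lemma path_in_unique_cylinder:
  assumes "J \<subseteq> T" "\<omega> \<in> space M"
  shows "\<exists>!u. u \<in> (\<Pi>\<^sub>E k\<in>J. \<S>) \<and> (\<forall>k\<in>J. X k \<omega> = u k)"
proof (rule ex1I[of _ "restrict (\<lambda>k. X k \<omega>) J"])
  show "restrict (\<lambda>k. X k \<omega>) J \<in> (\<Pi>\<^sub>E k\<in>J. \<S>) \<and> (\<forall>k\<in>J. X k \<omega> = restrict (\<lambda>k. X k \<omega>) J k)"
    using assms state_in_space by auto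
next
  fix u assume "u \<in> (\<Pi>\<^sub>E k\<in>J. \<S>) \<and> (\<forall>k\<in>J. X k \<omega> = u k)"
  then show "u = restrict (\<lambda>k. X k \<omega>) J"
    using assms state_in_space by (intro PiE_ext[where k = J and s = "\<lambda>_. \<S>"]) auto
qed

lemma finite_window_event:
  assumes "finite J" "J \<subseteq> T" "depends_only_on U J"
  shows "{\<omega> \<in> space M. U (\<lambda>k. X k \<omega>)} \<in> events"
proof -
  have "{\<omega> \<in> space M. U (\<lambda>k. X k \<omega>)} =
      (\<Union>u\<in>{u \<in> \<Pi>\<^sub>E k\<in>J. \<S>. U u}. {\<omega> \<in> space M. \<forall>k\<in>J. X k \<omega> = u k})"
    (is "?L = ?R")
  proof (intro subset_antisym subsetI)
    fix \<omega> assume \<omega>: "\<omega> \<in> ?L"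
    then obtain u where "u \<in> (\<Pi>\<^sub>E k\<in>J. \<S>)" "\<forall>k\<in>J. X k \<omega> = u k"
      using path_in_unique_cylinder[OF assms(2), of \<omega>] by auto
    then show "\<omega> \<in> ?R"
      using \<omega> depends_only_onD[OF assms(3), of "\<lambda>k. X k \<omega>" u] by auto
  next
    fix \<omega> assume "\<omega> \<in> ?R"
    then obtain u where "\<omega> \<in> space M" "U u" "\<forall>k\<in>J. X k \<omega> = u k"
      by auto
    then show "\<omega> \<in> ?L"
      using depends_only_onD[OF assms(3), of "\<lambda>k. X k \<omega>" u] by auto
  qed
  moreover have "finite {u \<in> \<Pi>\<^sub>E k\<in>J. \<S>. U u}"
    using assms(1) finite_states by (simp add: finite_PiE)
  ultimately show ?thesis
    using cylinder_event[OF assms(1,2)] by (simp add: sets.finite_UN)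
qed

text \<open>
  The further event \<open>Q\<close> allows a joint probability to be expanded in two rounds, over the past
  paths and over the future paths.
\<close>

lemma prob_sum_over_paths:
  assumes J: "finite J" "J \<subseteq> T" and U: "depends_only_on U J"
    and Q: "{\<omega> \<in> space M. Q \<omega>} \<in> events"
  shows "\<P>(\<omega> in M. Q \<omega> \<and> U (\<lambda>k. X k \<omega>)) =
    (\<Sum>u\<in>{u \<in> \<Pi>\<^sub>E k\<in>J. \<S>. U u}. \<P>(\<omega> in M. Q \<omega> \<and> (\<forall>k\<in>J. X k \<omega> = u k)))"
proof (rule prob_sum)
  show "finite {u \<in> \<Pi>\<^sub>E k\<in>J. \<S>. U u}"
    using J(1) finite_states by (simp add: finite_PiE)
  show "{\<omega> \<in> space M. Q \<omega> \<and> (\<forall>k\<in>J. X k \<omega> = u k)} \<in> events" for u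
    by (intro sets.sets_Collect_conj Q cylinder_event J)
  show "{\<omega> \<in> space M. Q \<omega> \<and> U (\<lambda>k. X k \<omega>)} \<in> events"
    by (intro sets.sets_Collect_conj Q finite_window_event[OF J U])
  show "AE \<omega> in M.
      (\<forall>u\<in>{u \<in> \<Pi>\<^sub>E k\<in>J. \<S>. U u}. Q \<omega> \<and> (\<forall>k\<in>J. X k \<omega> = u k) \<longrightarrow> Q \<omega> \<and> U (\<lambda>k. X k \<omega>)) \<and>
      (Q \<omega> \<and> U (\<lambda>k. X k \<omega>) \<longrightarrow>
        (\<exists>!u. u \<in> {u \<in> \<Pi>\<^sub>E k\<in>J. \<S>. U u} \<and> (Q \<omega> \<and> (\<forall>k\<in>J. X k \<omega> = u k))))"
  proof (rule AE_I2, intro conjI ballI impI)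
    fix \<omega> u assume "u \<in> {u \<in> \<Pi>\<^sub>E k\<in>J. \<S>. U u}" "Q \<omega> \<and> (\<forall>k\<in>J. X k \<omega> = u k)"
    then show "Q \<omega>" and "U (\<lambda>k. X k \<omega>)"
      using depends_only_onD[OF U, of "\<lambda>k. X k \<omega>" u] by auto
  next
    fix \<omega> assume "\<omega> \<in> space M" "Q \<omega> \<and> U (\<lambda>k. X k \<omega>)"
    then show "\<exists>!u. u \<in> {u \<in> \<Pi>\<^sub>E k\<in>J. \<S>. U u} \<and> (Q \<omega> \<and> (\<forall>k\<in>J. X k \<omega> = u k))"
      using path_in_unique_cylinder[OF J(2), of \<omega>] depends_only_onD[OF U, of "\<lambda>k. X k \<omega>"]
      by (smt (verit) mem_Collect_eq)
  qed
qed

section \<open>Conditional independence of past and future\<close>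

text \<open>
  The Markov property without division, so that it also holds for paths of probability zero.
\<close>

lemma markov_property_product:
  assumes T: "m \<in> T" "n + 1 \<in> T" and mn: "m \<le> n"
  shows "\<P>(\<omega> in M. \<forall>k\<in>{m..n+1}. X k \<omega> = x k) * \<P>(\<omega> in M. X n \<omega> = x n) =
    \<P>(\<omega> in M. \<forall>k\<in>{m..n}. X k \<omega> = x k) * \<P>(\<omega> in M. X (n + 1) \<omega> = x (n + 1) \<and> X n \<omega> = x n)"
proof -
  have sub: "{m..n+1} \<subseteq> T"
    using interval_subset_time_set[OF T] .
  then have nT: "n \<in> T"
    using mn by auto
  have subn: "{m..n} \<subseteq> T"
    using sub by auto
  have mono_n: "\<P>(\<omega> in M. \<forall>k\<in>{m..n}. X k \<omega> = x k) \<le> \<P>(\<omega> in M. X n \<omega> = x n)"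
    using mn nT by (intro finite_measure_mono state_event) auto
  have split: "\<P>(\<omega> in M. \<forall>k\<in>{m..n+1}. X k \<omega> = x k) =
      \<P>(\<omega> in M. X (n + 1) \<omega> = x (n + 1) \<and> (\<forall>k\<in>{m..n}. X k \<omega> = x k))"
  proof -
    have "{m..n+1} = insert (n + 1) {m..n}"
      using mn by auto
    then show ?thesis
      by simp
  qed
  show ?thesis
  proof (cases "\<P>(\<omega> in M. \<forall>k\<in>{m..n}. X k \<omega> = x k) > 0")
    case True
    then show ?thesis
      using markov_property[OF T(1) nT T(2) mn True, of "x (n + 1)"] mono_n
      unfolding split cond_prob_def by (simp add: field_simps)
  next
    case False
    then have zero: "\<P>(\<omega> in M. \<forall>k\<in>{m..n}. X k \<omega> = x k) = 0"
      by (simp add: zero_less_measure_iff)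
    have "\<P>(\<omega> in M. \<forall>k\<in>{m..n+1}. X k \<omega> = x k) \<le> \<P>(\<omega> in M. \<forall>k\<in>{m..n}. X k \<omega> = x k)"
      using subn by (intro finite_measure_mono cylinder_event) auto
    with zero have "\<P>(\<omega> in M. \<forall>k\<in>{m..n+1}. X k \<omega> = x k) = 0"
      by (simp only: measure_le_0_iff)
    with zero show ?thesis
      by simp
  qed
qed

text \<open>
  Induction on \<open>r\<close>: prolonging the path by one step multiplies the probability of the stretch from
  \<open>m\<close> and that of the stretch from \<open>n\<close> by the same factor, the transition probability at time \<open>r\<close>,
  because the Markov property forgets where a stretch began.
\<close>

lemma cylinder_factorization:
  assumes "m \<in> T" "r \<in> T" "m \<le> n" "n \<le> r"
  shows "\<P>(\<omega> in M. \<forall>k\<in>{m..r}. X k \<omega> = x k) * \<P>(\<omega> in M. X n \<omega> = x n) =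
    \<P>(\<omega> in M. \<forall>k\<in>{m..n}. X k \<omega> = x k) * \<P>(\<omega> in M. \<forall>k\<in>{n..r}. X k \<omega> = x k)"
  using assms(4,2)
proof (induction r rule: int_ge_induct)
  case base
  then show ?case
    by simp
next
  case (step r)
  have sub: "{m..r+1} \<subseteq> T"
    using interval_subset_time_set[OF assms(1) step.prems] .
  then have rT: "r \<in> T" and nT: "n \<in> T"
    using assms(3) step.hyps by auto
  let ?L = "\<lambda>a b. \<P>(\<omega> in M. \<forall>k\<in>{a..b}. X k \<omega> = x k)"
  let ?p = "\<lambda>k. \<P>(\<omega> in M. X k \<omega> = x k)"
  let ?t = "\<P>(\<omega> in M. X (r + 1) \<omega> = x (r + 1) \<and> X r \<omega> = x r)"
  have from_m: "?L m (r + 1) * ?p r = ?L m r * ?t"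
    using markov_property_product[OF assms(1) step.prems, of x] assms(3) step.hyps by simp
  have from_n: "?L n (r + 1) * ?p r = ?L n r * ?t"
    using markov_property_product[OF nT step.prems step.hyps, of x] .
  show ?case
  proof (cases "?p r = 0")
    case True
    have "?L a (r + 1) \<le> ?p r" if "a \<le> r" for a
      using that rT by (intro finite_measure_mono state_event) auto
    then have "?L a (r + 1) = 0" if "a \<le> r" for a
      using that True by (simp only: measure_le_0_iff)
    then show ?thesis
      using assms(3) step.hyps by simp
  next
    case False
    \<comment> \<open>Cleared of denominators, the transition probability is \<open>?t / ?p r\<close>.\<close>
    have "(?L m (r + 1) * ?p n) * ?p r = (?L m (r + 1) * ?p r) * ?p n"
      by (simp only: mult_ac)
    also have "\<dots> = (?L m r * ?t) * ?p n"
      by (simp only: from_m)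
    also have "\<dots> = (?L m r * ?p n) * ?t"
      by (simp only: mult_ac)
    also have "\<dots> = ?L m n * (?L n r * ?t)"
      by (simp only: step.IH[OF rT] mult.assoc)
    also have "\<dots> = (?L m n * ?L n (r + 1)) * ?p r"
      by (simp only: from_n mult.assoc)
    finally show ?thesis
      using False by simp
  qed
qed

text \<open>
  Sum \<open>cylinder_factorization\<close> over all pairs of a past and a future path: since both are in \<open>i\<close>
  at time \<open>n\<close>, the factor \<open>P(X n = i)\<close> is common to all pairs.
\<close>

lemma interval_window_factorization:
  assumes T: "m \<in> T" "r \<in> T" and le: "m \<le> n" "n \<le> r"
    and U: "depends_only_on U {m..n}" and V: "depends_only_on V {n..r}"
    and Ui: "\<And>x. U x \<Longrightarrow> x n = i" and Vi: "\<And>x. V x \<Longrightarrow> x n = i"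
  shows "\<P>(\<omega> in M. U (\<lambda>k. X k \<omega>) \<and> V (\<lambda>k. X k \<omega>)) * \<P>(\<omega> in M. X n \<omega> = i) =
    \<P>(\<omega> in M. U (\<lambda>k. X k \<omega>)) * \<P>(\<omega> in M. V (\<lambda>k. X k \<omega>))"
proof -
  have "{m..r} \<subseteq> T"
    using interval_subset_time_set[OF T] .
  then have J: "{m..n} \<subseteq> T" and K: "{n..r} \<subseteq> T"
    using le by auto
  let ?PU = "{u \<in> \<Pi>\<^sub>E k\<in>{m..n}. \<S>. U u}"
  let ?PV = "{v \<in> \<Pi>\<^sub>E k\<in>{n..r}. \<S>. V v}"
  let ?in = "\<lambda>J u \<omega>. \<forall>k\<in>J. X k \<omega> = u k"
  have all: "{\<omega> \<in> space M. True} \<in> events"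
    by simp
  have pair: "\<P>(\<omega> in M. ?in {m..n} u \<omega> \<and> ?in {n..r} v \<omega>) * \<P>(\<omega> in M. X n \<omega> = i) =
      \<P>(\<omega> in M. ?in {m..n} u \<omega>) * \<P>(\<omega> in M. ?in {n..r} v \<omega>)"
    if "u \<in> ?PU" "v \<in> ?PV" for u v
  proof -
    \<comment> \<open>The two paths agree at the one common time \<open>n\<close>, so they can be glued.\<close>
    define x where "x k = (if k \<le> n then u k else v k)" for k
    have un: "u n = i" and vn: "v n = i"
      using that Ui Vi by auto
    have past: "?in {m..n} u \<omega> \<longleftrightarrow> ?in {m..n} x \<omega>" for \<omega>
      by (simp add: x_def)
    have "x k = v k" if "k \<in> {n..r}" for k
      using that un vn by (cases "k = n") (simp_all add: x_def)
    then have future: "?in {n..r} v \<omega> \<longleftrightarrow> ?in {n..r} x \<omega>" for \<omega>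
      by simp
    have "{m..r} = {m..n} \<union> {n..r}"
      using le by auto
    then have both: "?in {m..n} x \<omega> \<and> ?in {n..r} x \<omega> \<longleftrightarrow> ?in {m..r} x \<omega>" for \<omega>
      by (simp add: ball_Un)
    have "x n = i"
      using un by (simp add: x_def)
    then show ?thesis
      using cylinder_factorization[OF T le, of x] by (simp only: past future both)
  qed
  have "\<P>(\<omega> in M. U (\<lambda>k. X k \<omega>) \<and> V (\<lambda>k. X k \<omega>)) =
      (\<Sum>v\<in>?PV. \<P>(\<omega> in M. U (\<lambda>k. X k \<omega>) \<and> ?in {n..r} v \<omega>))"
    by (intro prob_sum_over_paths finite_window_event[OF _ J U] K V) auto
  also have "\<dots> = (\<Sum>v\<in>?PV. \<Sum>u\<in>?PU. \<P>(\<omega> in M. ?in {m..n} u \<omega> \<and> ?in {n..r} v \<omega>))"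
    using prob_sum_over_paths[OF _ J U cylinder_event[OF _ K]]
    by (intro sum.cong) (simp_all add: conj_commute)
  finally have "\<P>(\<omega> in M. U (\<lambda>k. X k \<omega>) \<and> V (\<lambda>k. X k \<omega>)) * \<P>(\<omega> in M. X n \<omega> = i) =
      (\<Sum>v\<in>?PV. \<Sum>u\<in>?PU. \<P>(\<omega> in M. ?in {m..n} u \<omega>) * \<P>(\<omega> in M. ?in {n..r} v \<omega>))"
    using pair by (simp add: sum_distrib_right)
  also have "\<dots> = (\<Sum>u\<in>?PU. \<P>(\<omega> in M. ?in {m..n} u \<omega>)) * (\<Sum>v\<in>?PV. \<P>(\<omega> in M. ?in {n..r} v \<omega>))"
    by (simp add: sum_product sum.swap[of _ ?PV])
  also have "(\<Sum>u\<in>?PU. \<P>(\<omega> in M. ?in {m..n} u \<omega>)) = \<P>(\<omega> in M. U (\<lambda>k. X k \<omega>))"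
    using prob_sum_over_paths[OF _ J U all] by simp
  also have "(\<Sum>v\<in>?PV. \<P>(\<omega> in M. ?in {n..r} v \<omega>)) = \<P>(\<omega> in M. V (\<lambda>k. X k \<omega>))"
    using prob_sum_over_paths[OF _ K V all] by simp
  finally show ?thesis .
qed

text \<open>
  A finite set of times lies in an interval with end points in the time set, and the event
  \<open>X n = i\<close> depends only on the time \<open>n\<close> shared by the two intervals.
\<close>

lemma finite_window_factorization:
  assumes n: "n \<in> T" and J: "finite J" "J \<subseteq> T \<inter> {..n}" and K: "finite K" "K \<subseteq> T \<inter> {n..}"
    and U: "depends_only_on U J" and V: "depends_only_on V K"
  shows "\<P>(\<omega> in M. X n \<omega> = i \<and> U (\<lambda>k. X k \<omega>) \<and> V (\<lambda>k. X k \<omega>)) * \<P>(\<omega> in M. X n \<omega> = i) =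
    \<P>(\<omega> in M. X n \<omega> = i \<and> U (\<lambda>k. X k \<omega>)) * \<P>(\<omega> in M. X n \<omega> = i \<and> V (\<lambda>k. X k \<omega>))"
proof -
  define m where "m = Min (insert n J)"
  define r where "r = Max (insert n K)"
  have m: "m \<in> insert n J" and r: "r \<in> insert n K"
    unfolding m_def r_def by (rule Min_in Max_in; use J(1) K(1) in simp)+
  then have T: "m \<in> T" "r \<in> T" and le: "m \<le> n" "n \<le> r"
    using n J(2) K(2) by auto
  have "J \<subseteq> {m..n}" "K \<subseteq> {n..r}"
    unfolding m_def r_def using J K by auto
  then have U': "depends_only_on (\<lambda>x. x n = i \<and> U x) {m..n}"
    and V': "depends_only_on (\<lambda>x. x n = i \<and> V x) {n..r}"
    using U V le unfolding depends_only_on_def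
    by (metis atLeastAtMost_iff order_refl subsetD)+
  show ?thesis
    using interval_window_factorization[OF T le U' V', of i]
    by (simp add: conj_ac)
qed

text \<open>
  The windows \<open>J p\<close> and \<open>K p\<close> may grow with \<open>p\<close>, so the limit events can involve the whole past
  and the whole future. A single limit along the diagonal suffices: by monotonicity, if past
  and future events occur at different indices, then they both occur at the larger one.
\<close>

lemma past_future_factorization:
  assumes n: "n \<in> T"
    and J: "\<And>p. finite (J p)" "\<And>p. J p \<subseteq> T \<inter> {..n}"
    and K: "\<And>p. finite (K p)" "\<And>p. K p \<subseteq> T \<inter> {n..}"
    and U: "\<And>p. depends_only_on (U p) (J p)" and V: "\<And>p. depends_only_on (V p) (K p)"
    and U_mono: "\<And>p x. U p x \<Longrightarrow> U (Suc p) x" and V_mono: "\<And>p x. V p x \<Longrightarrow> V (Suc p) x"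
  shows "\<P>(\<omega> in M. X n \<omega> = i \<and> (\<exists>p::nat. U p (\<lambda>k. X k \<omega>)) \<and> (\<exists>p. V p (\<lambda>k. X k \<omega>))) *
      \<P>(\<omega> in M. X n \<omega> = i) =
    \<P>(\<omega> in M. X n \<omega> = i \<and> (\<exists>p. U p (\<lambda>k. X k \<omega>))) *
      \<P>(\<omega> in M. X n \<omega> = i \<and> (\<exists>p. V p (\<lambda>k. X k \<omega>)))"
proof -
  have limit: "(\<lambda>p. \<P>(\<omega> in M. X n \<omega> = i \<and> W p (\<lambda>k. X k \<omega>))) \<longlonglongrightarrow>
      \<P>(\<omega> in M. X n \<omega> = i \<and> (\<exists>p. W p (\<lambda>k. X k \<omega>)))"
    if "\<And>p. finite (L p)" "\<And>p. L p \<subseteq> T" "\<And>p. depends_only_on (W p) (L p)"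
      and mono: "\<And>p x. W p x \<Longrightarrow> W (Suc p) x" for L and W :: "nat \<Rightarrow> (int \<Rightarrow> 's) \<Rightarrow> bool"
  proof -
    let ?E = "\<lambda>p. {\<omega> \<in> space M. X n \<omega> = i \<and> W p (\<lambda>k. X k \<omega>)}"
    have "range ?E \<subseteq> events"
      using that(1-3)
      by (auto intro!: sets.sets_Collect_conj state_event[OF n] finite_window_event[of "L _"])
    moreover have "incseq ?E"
      using mono by (auto intro!: incseq_SucI)
    ultimately have "(\<lambda>p. prob (?E p)) \<longlonglongrightarrow> prob (\<Union>p. ?E p)"
      by (rule finite_Lim_measure_incseq)
    moreover have "(\<Union>p. ?E p) = {\<omega> \<in> space M. X n \<omega> = i \<and> (\<exists>p. W p (\<lambda>k. X k \<omega>))}"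
      by auto
    ultimately show ?thesis
      by simp
  qed
  have U_le: "U p x \<Longrightarrow> p \<le> q \<Longrightarrow> U q x" and V_le: "V p x \<Longrightarrow> p \<le> q \<Longrightarrow> V q x" for p q x
    using lift_Suc_mono_le[of "\<lambda>p. U p x" p q] lift_Suc_mono_le[of "\<lambda>p. V p x" p q] U_mono V_mono
    by auto
  have diagonal: "(\<exists>p. U p x \<and> V p x) \<longleftrightarrow> (\<exists>p. U p x) \<and> (\<exists>p. V p x)" for x
    by (metis U_le V_le nat_le_linear)
  let ?P = "\<P>(\<omega> in M. X n \<omega> = i)"
  have "(\<lambda>p. \<P>(\<omega> in M. X n \<omega> = i \<and> U p (\<lambda>k. X k \<omega>) \<and> V p (\<lambda>k. X k \<omega>)) * ?P) \<longlonglongrightarrow>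
      \<P>(\<omega> in M. X n \<omega> = i \<and> (\<exists>p. U p (\<lambda>k. X k \<omega>) \<and> V p (\<lambda>k. X k \<omega>))) * ?P"
    using J K U_mono V_mono
    by (intro tendsto_mult_right limit[of "\<lambda>p. J p \<union> K p" "\<lambda>p x. U p x \<and> V p x"]
        depends_only_on_conj U V) auto
  moreover have "(\<lambda>p. \<P>(\<omega> in M. X n \<omega> = i \<and> U p (\<lambda>k. X k \<omega>)) *
        \<P>(\<omega> in M. X n \<omega> = i \<and> V p (\<lambda>k. X k \<omega>))) \<longlonglongrightarrow>
      \<P>(\<omega> in M. X n \<omega> = i \<and> (\<exists>p. U p (\<lambda>k. X k \<omega>))) *
        \<P>(\<omega> in M. X n \<omega> = i \<and> (\<exists>p. V p (\<lambda>k. X k \<omega>)))"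
    using J K U_mono V_mono
    by (intro tendsto_mult limit[of J U] limit[of K V] U V) auto
  ultimately show ?thesis
    unfolding diagonal finite_window_factorization[OF n J K U V]
    by (rule LIMSEQ_unique)
qed

section \<open>Reactive trajectories\<close>

text \<open>
  Restricting the witnessing times of the two events to distance at most \<open>p\<close> from \<open>n\<close> makes them
  depend only on the times in that range.
\<close>

lemma reactive_factorization:
  assumes n: "n \<in> T"
  shows "\<P>(\<omega> in M. X n \<omega> = i \<and> last_exit T X B n \<omega> < last_exit T X A n \<omega> \<and>
        first_entrance T X B n \<omega> < first_entrance T X A n \<omega>) * \<P>(\<omega> in M. X n \<omega> = i) =
    \<P>(\<omega> in M. X n \<omega> = i \<and> last_exit T X B n \<omega> < last_exit T X A n \<omega>) *
      \<P>(\<omega> in M. X n \<omega> = i \<and> first_entrance T X B n \<omega> < first_entrance T X A n \<omega>)"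
proof -
  define J where "J p = T \<inter> {n - int p..n}" for p
  define K where "K p = T \<inter> {n..n + int p}" for p
  define U where "U p x \<longleftrightarrow> (\<exists>k\<in>J p. x k \<in> A \<and> (\<forall>l\<in>T \<inter> {k..n}. x l \<notin> B))"
    for p and x :: "int \<Rightarrow> 's"
  define V where "V p x \<longleftrightarrow> (\<exists>k\<in>K p. x k \<in> B \<and> (\<forall>l\<in>T \<inter> {n..k}. x l \<notin> A))"
    for p and x :: "int \<Rightarrow> 's"
  have past: "last_exit T X B n \<omega> < last_exit T X A n \<omega> \<longleftrightarrow> (\<exists>p. U p (\<lambda>k. X k \<omega>))" for \<omega>
  proof -
    have "\<exists>p. k \<in> J p" if "k \<in> T" "k \<le> n" for k
      using that by (intro exI[of _ "nat (n - k)"]) (auto simp: J_def)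
    moreover have "k \<in> T \<and> k \<le> n" if "k \<in> J p" for k p
      using that by (auto simp: J_def)
    ultimately show ?thesis
      unfolding last_exit_less_iff U_def by blast
  qed
  have future: "first_entrance T X B n \<omega> < first_entrance T X A n \<omega> \<longleftrightarrow>
      (\<exists>p. V p (\<lambda>k. X k \<omega>))" for \<omega>
  proof -
    have "\<exists>p. k \<in> K p" if "k \<in> T" "n \<le> k" for k
      using that by (intro exI[of _ "nat (k - n)"]) (auto simp: K_def)
    moreover have "k \<in> T \<and> n \<le> k" if "k \<in> K p" for k p
      using that by (auto simp: K_def)
    ultimately show ?thesis
      unfolding first_entrance_less_iff V_def by blast
  qed
  have U: "depends_only_on (U p) (J p)" for p
    unfolding depends_only_on_def
  proof (intro allI impI)
    fix x y :: "int \<Rightarrow> 's" assume eq: "\<forall>k\<in>J p. x k = y k"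
    have "T \<inter> {k..n} \<subseteq> J p" if "k \<in> J p" for k
      using that by (auto simp: J_def)
    then have "(x k \<in> A \<and> (\<forall>l\<in>T \<inter> {k..n}. x l \<notin> B)) \<longleftrightarrow>
        (y k \<in> A \<and> (\<forall>l\<in>T \<inter> {k..n}. y l \<notin> B))" if "k \<in> J p" for k
      using that eq by (metis subsetD)
    then show "U p x = U p y"
      unfolding U_def by (rule bex_cong[OF refl])
  qed
  have V: "depends_only_on (V p) (K p)" for p
    unfolding depends_only_on_def
  proof (intro allI impI)
    fix x y :: "int \<Rightarrow> 's" assume eq: "\<forall>k\<in>K p. x k = y k"
    have "T \<inter> {n..k} \<subseteq> K p" if "k \<in> K p" for k
      using that by (auto simp: K_def)
    then have "(x k \<in> B \<and> (\<forall>l\<in>T \<inter> {n..k}. x l \<notin> A)) \<longleftrightarrow>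
        (y k \<in> B \<and> (\<forall>l\<in>T \<inter> {n..k}. y l \<notin> A))" if "k \<in> K p" for k
      using that eq by (metis subsetD)
    then show "V p x = V p y"
      unfolding V_def by (rule bex_cong[OF refl])
  qed
  have "J p \<subseteq> J (Suc p)" "K p \<subseteq> K (Suc p)" for p
    by (auto simp: J_def K_def)
  then have "U p x \<Longrightarrow> U (Suc p) x" "V p x \<Longrightarrow> V (Suc p) x" for p x
    unfolding U_def V_def by blast+
  moreover have "finite (J p)" "J p \<subseteq> T \<inter> {..n}" "finite (K p)" "K p \<subseteq> T \<inter> {n..}" for p
    by (auto simp: J_def K_def)
  ultimately show ?thesis
    unfolding past future by (intro past_future_factorization[OF n _ _ _ _ U V])
qed

end

theorem theorem2p2:
  fixes M :: "'w measure" and T :: "int set" and \<S> A B C :: "'s set"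
    and X :: "int \<Rightarrow> 'w \<Rightarrow> 's" and qp qm :: "int \<Rightarrow> 's \<Rightarrow> real"
  assumes "markov_chain M T \<S> X"
    and "A \<subseteq> \<S>" and "B \<subseteq> \<S>" and "A \<noteq> {}" and "B \<noteq> {}" and "A \<inter> B = {}"
    and "C = \<S> - (A \<union> B)" and "C \<noteq> {}"
    and "forward_committor M T \<S> X A B qp"
    and "backward_committor M T \<S> X A B qm"
  shows "(\<forall>n\<in>T. \<forall>i\<in>C. reactive_distribution M T X A B n i =
            qm n i * \<P>(\<omega> in M. X n \<omega> = i) * qp n i) \<and>
         (\<forall>n\<in>T. \<forall>i\<in>\<S>. reactive_distribution M T X A B n i =
            qm n i * \<P>(\<omega> in M. X n \<omega> = i) * qp n i)"
proof -
  interpret markov_chain M T \<S> X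
    by fact
  have product: "reactive_distribution M T X A B n i =
      qm n i * \<P>(\<omega> in M. X n \<omega> = i) * qp n i" if n: "n \<in> T" and i: "i \<in> \<S>" for n i
  proof (cases "\<P>(\<omega> in M. X n \<omega> = i) = 0")
    case True
    have "reactive_distribution M T X A B n i \<le> \<P>(\<omega> in M. X n \<omega> = i)"
      unfolding reactive_distribution_def by (intro finite_measure_mono state_event n) auto
    with True have "reactive_distribution M T X A B n i = 0"
      unfolding reactive_distribution_def by (simp only: measure_le_0_iff)
    with True show ?thesis
      by simp
  next
    case False
    then have pos: "\<P>(\<omega> in M. X n \<omega> = i) > 0"
      by (simp add: zero_less_measure_iff)
    let ?P = "\<P>(\<omega> in M. X n \<omega> = i)"
    have "qp n i = \<P>(\<omega> in M. first_entrance T X B n \<omega> < first_entrance T X A n \<omega> \<bar> X n \<omega> = i)"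
      using \<open>forward_committor M T \<S> X A B qp\<close> n i pos unfolding forward_committor_def by blast
    then have forward: "qp n i * ?P =
        \<P>(\<omega> in M. X n \<omega> = i \<and> first_entrance T X B n \<omega> < first_entrance T X A n \<omega>)"
      using pos unfolding cond_prob_def by (simp add: conj_commute)
    have "qm n i = \<P>(\<omega> in M. last_exit T X B n \<omega> < last_exit T X A n \<omega> \<bar> X n \<omega> = i)"
      using \<open>backward_committor M T \<S> X A B qm\<close> n i pos unfolding backward_committor_def by blast
    then have backward: "qm n i * ?P =
        \<P>(\<omega> in M. X n \<omega> = i \<and> last_exit T X B n \<omega> < last_exit T X A n \<omega>)"
      using pos unfolding cond_prob_def by (simp add: conj_commute)
    have "reactive_distribution M T X A B n i * ?P = (qm n i * ?P) * (qp n i * ?P)"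
      unfolding reactive_distribution_def forward backward by (rule reactive_factorization[OF n])
    then show ?thesis
      using pos by simp
  qed
  moreover have "C \<subseteq> \<S>"
    using \<open>C = \<S> - (A \<union> B)\<close> by blast
  ultimately show ?thesis
    by blast
qed

end
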